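(* Let $\lambda_{\max}=\lambda_0>\lambda_1>\cdots>\lambda_{\mathcal{K}}>0$ be a sequence of parameter values. For each $k$ let $W^*(\lambda_k)$ be an optimal solution of the MTFL problem with parameter $\lambda_k$, with columns $\mathbf{w}_t^*(\lambda_k)$ and rows $(\mathbf{w}^\ell)^*(\lambda_k)$. Then for any $k=1,2,\ldots,\mathcal{K}-1$ and any $\ell\in\{1,\ldots,d\}$, with $s_\ell(\lambda_{k+1},\lambda_k)=\max_{\theta\in\mathbf{\Theta}(\lambda_{k+1},\lambda_k)}g_\ell(\theta)$ computed from the known solution $W^*(\lambda_k)$ through $\theta_t^*(\lambda_k)=(\mathbf{y}_t-X_t\mathbf{w}_t^*(\lambda_k))/\lambda_k$, $t=1,\ldots,T$, we have $$s_\ell(\lambda_{k+1},\lambda_k)<1\ \Longrightarrow\ (\mathbf{w}^\ell)^*(\lambda_{k+1})=0.$$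
   Context: Let $T,d,N_1,\ldots,N_T$ be positive integers and $N=\sum_{t=1}^T N_t$. For $t=1,\ldots,T$ let $X_t\in\mathbb{R}^{N_t\times d}$ be a data matrix with $\ell$-th column $\mathbf{x}_\ell^{(t)}\in\mathbb{R}^{N_t}$, and let $\mathbf{y}_t\in\mathbb{R}^{N_t}$. Vectors $\theta\in\mathbb{R}^N$ are partitioned into blocks $\theta=(\theta_1,\ldots,\theta_T)$ with $\theta_t\in\mathbb{R}^{N_t}$, and $\mathbf{y}=(\mathbf{y}_1,\ldots,\mathbf{y}_T)\in\mathbb{R}^N$. $\|\cdot\|$ is the Euclidean norm. The MTFL (multi-task feature learning) problem with parameter $\lambda>0$ is $$\min_{W\in\mathbb{R}^{d\times T}}\ \sum_{t=1}^T\tfrac12\|\mathbf{y}_t-X_t\mathbf{w}_t\|^2+\lambda\sum_{\ell=1}^d\|\mathbf{w}^\ell\|,$$ where $\mathbf{w}_t$ is the $t$-th column and $\mathbf{w}^\ell$ the $\ell$-th row of $W$. For $\ell=1,\ldots,d$ let $g_\ell(\theta)=\sum_{t=1}^T\langle\mathbf{x}_\ell^{(t)},\theta_t\rangle^2$ on $\mathbb{R}^N$. Let $$\mathcal{F}=\{\theta\in\mathbb{R}^N:\ g_\ell(\theta)\le1,\ \ell=1,\ldots,d\},\qquad \lambda_{\max}=\max_{\ell}\sqrt{g_\ell(\mathbf{y})}.$$ For $\lambda>0$ the dual optimal solution is $\theta^*(\lambda)=\mathrm{P}_{\mathcal{F}}(\mathbf{y}/\lambda)$, the Euclidean projection of $\mathbf{y}/\lambda$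 onto $\mathcal{F}$; by the KKT conditions it is related to any primal optimal solution by $\mathbf{y}_t=X_t\mathbf{w}_t^*(\lambda)+\lambda\theta_t^*(\lambda)$, $t=1,\ldots,T$. Fix $\ell_*\in\operatorname{argmax}_\ell g_\ell(\mathbf{y})$. For $0<\lambda<\lambda'\le\lambda_{\max}$ define $$\mathbf{n}(\lambda')=\begin{cases}\mathbf{y}/\lambda'-\theta^*(\lambda'), & \lambda'<\lambda_{\max},\\ \nabla g_{\ell_*}(\mathbf{y}/\lambda_{\max}), & \lambda'=\lambda_{\max},\end{cases}\qquad \mathbf{r}(\lambda,\lambda')=\frac{\mathbf{y}}{\lambda}-\theta^*(\lambda'),$$ $$\mathbf{r}^{\perp}(\lambda,\lambda')=\mathbf{r}(\lambda,\lambda')-\frac{\langle\mathbf{n}(\lambda'),\mathbf{r}(\lambda,\lambda')\rangle}{\|\mathbf{n}(\lambda')\|^2}\mathbf{n}(\lambda'),\qquad \mathbf{o}(\lambda,\lambda')=\theta^*(\lambda')+\tfrac12\mathbf{r}^{\perp}(\lambda,\lambda'),$$ $$\mathbf{\Theta}(\lambda,\lambda')=\left\{\theta\in\mathbb{R}^N:\ \|\theta-\mathbf{o}(\lambda,\lambda')\|\le\tfrac12\|\mathbf{r}^{\perp}(\lambda,\lambda')\|\right\}.$$ *)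

theory Defs
  imports "HOL-Analysis.Analysis"
begin

text \<open>
  The \<open>N\<close> coordinates are the elements of the finite type \<open>'n\<close>, and \<open>b i\<close> is the
  task to which coordinate \<open>i\<close> belongs, so \<open>N_t\<close> is the number of \<open>i\<close> with \<open>b i = t\<close>, and
  surjectivity of \<open>b\<close> says that every \<open>N_t\<close> is positive.  The matrices \<open>X_t\<close> are stacked into
  one matrix \<open>X\<close>.  The block \<open>v_t\<close> of a vector, and the matrix \<open>X_t\<close>, are represented
  by padding with zeros outside block \<open>t\<close>; this does not affect norms or inner products of blocks.
\<close>

definition block :: "('n::finite \<Rightarrow> 't) \<Rightarrow> real^'n \<Rightarrow> 't \<Rightarrow> real^'n" where
  "block b v t = (\<chi> i. if b i = t then v $ i else 0)"

definition mat_block :: "('n::finite \<Rightarrow> 't) \<Rightarrow> real^'d^'n \<Rightarrow> 't \<Rightarrow> real^'d^'n" where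
  "mat_block b X t = (\<chi> i j. if b i = t then X $ i $ j else 0)"

definition mtfl_objective ::
  "('n::finite \<Rightarrow> 't::finite) \<Rightarrow> real^'d^'n \<Rightarrow> real^'n \<Rightarrow> real \<Rightarrow> real^'t^'d \<Rightarrow> real" where
  "mtfl_objective b X y lam W =
     (\<Sum>t\<in>UNIV. 1/2 * (norm (block b y t - mat_block b X t *v column t W))\<^sup>2)
     + lam * (\<Sum>l\<in>UNIV. norm (row l W))"

definition mtfl_optimal ::
  "('n::finite \<Rightarrow> 't::finite) \<Rightarrow> real^'d^'n \<Rightarrow> real^'n \<Rightarrow> real \<Rightarrow> real^'t^'d \<Rightarrow> bool" where
  "mtfl_optimal b X y lam W \<longleftrightarrow> is_arg_min (mtfl_objective b X y lam) (\<lambda>_. True) W"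

definition g_fun :: "('n::finite \<Rightarrow> 't::finite) \<Rightarrow> real^'d^'n \<Rightarrow> 'd \<Rightarrow> real^'n \<Rightarrow> real" where
  "g_fun b X l \<theta> = (\<Sum>t\<in>UNIV. (column l (mat_block b X t) \<bullet> block b \<theta> t)\<^sup>2)"

definition dual_feasible :: "('n::finite \<Rightarrow> 't::finite) \<Rightarrow> real^'d^'n \<Rightarrow> (real^'n) set" where
  "dual_feasible b X = {\<theta>. \<forall>l. g_fun b X l \<theta> \<le> 1}"

definition lambda_max ::
  "('n::finite \<Rightarrow> 't::finite) \<Rightarrow> real^'d^'n \<Rightarrow> real^'n \<Rightarrow> real" where
  "lambda_max b X y = (MAX l\<in>UNIV. sqrt (g_fun b X l y))"

definition dual_opt ::
  "('n::finite \<Rightarrow> 't::finite) \<Rightarrow> real^'d^'n \<Rightarrow> real^'n \<Rightarrow> real \<Rightarrow> real^'n" where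
  "dual_opt b X y lam = closest_point (dual_feasible b X) (y /\<^sub>R lam)"

definition gradient :: "('a::real_inner \<Rightarrow> real) \<Rightarrow> 'a \<Rightarrow> 'a" where
  "gradient f x = (THE D. GDERIV f x :> D)"

text \<open>
  In the following, \<open>ls\<close> is the chosen maximizing index and \<open>lam'\<close> is the reference
  parameter, at which the dual optimum is known.
\<close>

definition n_vec ::
  "('n::finite \<Rightarrow> 't::finite) \<Rightarrow> real^'d^'n \<Rightarrow> real^'n \<Rightarrow> 'd \<Rightarrow> real \<Rightarrow> real^'n" where
  "n_vec b X y ls lam' =
     (if lam' < lambda_max b X y then y /\<^sub>R lam' - dual_opt b X y lam'
      else gradient (g_fun b X ls) (y /\<^sub>R lambda_max b X y))"

definition r_vec ::
  "('n::finite \<Rightarrow> 't::finite) \<Rightarrow> real^'d^'n \<Rightarrow> real^'n \<Rightarrow> real \<Rightarrow> real \<Rightarrow> real^'n" where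
  "r_vec b X y lam lam' = y /\<^sub>R lam - dual_opt b X y lam'"

definition r_perp ::
  "('n::finite \<Rightarrow> 't::finite) \<Rightarrow> real^'d^'n \<Rightarrow> real^'n \<Rightarrow> 'd \<Rightarrow> real \<Rightarrow> real \<Rightarrow> real^'n" where
  "r_perp b X y ls lam lam' =
     r_vec b X y lam lam'
     - ((n_vec b X y ls lam' \<bullet> r_vec b X y lam lam') / (norm (n_vec b X y ls lam'))\<^sup>2)
       *\<^sub>R n_vec b X y ls lam'"

definition o_vec ::
  "('n::finite \<Rightarrow> 't::finite) \<Rightarrow> real^'d^'n \<Rightarrow> real^'n \<Rightarrow> 'd \<Rightarrow> real \<Rightarrow> real \<Rightarrow> real^'n" where
  "o_vec b X y ls lam lam' = dual_opt b X y lam' + (1/2) *\<^sub>R r_perp b X y ls lam lam'"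

definition Theta ::
  "('n::finite \<Rightarrow> 't::finite) \<Rightarrow> real^'d^'n \<Rightarrow> real^'n \<Rightarrow> 'd \<Rightarrow> real \<Rightarrow> real \<Rightarrow> (real^'n) set" where
  "Theta b X y ls lam lam' =
     {\<theta>. norm (\<theta> - o_vec b X y ls lam lam') \<le> 1/2 * norm (r_perp b X y ls lam lam')}"

text \<open>The supremum below is a maximum; see \<open>s_score_attained\<close>.\<close>

definition s_score ::
  "('n::finite \<Rightarrow> 't::finite) \<Rightarrow> real^'d^'n \<Rightarrow> real^'n \<Rightarrow> 'd \<Rightarrow> real \<Rightarrow> real \<Rightarrow> 'd \<Rightarrow> real" where
  "s_score b X y ls lam lam' l = (SUP \<theta>\<in>Theta b X y ls lam lam'. g_fun b X l \<theta>)"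

lemma continuous_on_g_fun: "continuous_on S (g_fun b X l)"
proof -
  have "continuous_on S (\<lambda>\<theta>. block b \<theta> t)" for t
    unfolding block_def
  proof (intro continuous_on_vec_lambda)
    fix i show "continuous_on S (\<lambda>x::real^'a. if b i = t then x $ i else 0)"
      by (cases "b i = t") (auto intro!: continuous_intros)
  qed
  then show ?thesis
    unfolding g_fun_def[abs_def] by (intro continuous_intros) auto
qed

lemma s_score_attained:
  "\<exists>\<theta>\<in>Theta b X y ls lam lam'. g_fun b X l \<theta> = s_score b X y ls lam lam' l
     \<and> (\<forall>\<theta>'\<in>Theta b X y ls lam lam'. g_fun b X l \<theta>' \<le> g_fun b X l \<theta>)"
proof -
  let ?T = "Theta b X y ls lam lam'"
  have eq: "?T = cball (o_vec b X y ls lam lam') (1/2 * norm (r_perp b X y ls lam lam'))"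
    unfolding Theta_def cball_def by (simp add: dist_norm norm_minus_commute)
  have "compact ?T" "?T \<noteq> {}" unfolding eq by auto
  then obtain \<theta> where \<theta>: "\<theta> \<in> ?T" "\<forall>\<theta>'\<in>?T. g_fun b X l \<theta>' \<le> g_fun b X l \<theta>"
    using continuous_attains_sup[OF _ _ continuous_on_g_fun] by blast
  then have "g_fun b X l \<theta> = s_score b X y ls lam lam' l"
    unfolding s_score_def by (intro cSup_eq_maximum[symmetric]) auto
  with \<theta> show ?thesis by blast
qed

lemma gradient_g_fun:
  "gradient (g_fun b X l) \<theta> =
     (\<Sum>t\<in>UNIV. (2 * (column l (mat_block b X t) \<bullet> block b \<theta> t)) *\<^sub>R column l (mat_block b X t))"
  (is "_ = ?D")
proof -
  have *: "column l (mat_block b X t) \<bullet> block b v t = column l (mat_block b X t) \<bullet> v" for t v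
    by (auto simp: inner_vec_def block_def column_def mat_block_def intro!: sum.cong)
  have "g_fun b X l = (\<lambda>v. \<Sum>t\<in>UNIV. (column l (mat_block b X t) \<bullet> v)\<^sup>2)"
    by (simp add: g_fun_def[abs_def] *)
  moreover have "((\<lambda>v. \<Sum>t\<in>UNIV. (column l (mat_block b X t) \<bullet> v)\<^sup>2)
      has_derivative (\<lambda>h. h \<bullet> ?D)) (at \<theta>)"
    unfolding *
    by (rule derivative_eq_intros refl has_derivative_power)+
       (simp add: inner_sum_right fun_eq_iff inner_commute mult_ac)
  ultimately have D: "GDERIV (g_fun b X l) \<theta> :> ?D"
    by (simp add: gderiv_def)
  show ?thesis
    unfolding gradient_def
  proof (rule the_equality[where P = "\<lambda>D. GDERIV (g_fun b X l) \<theta> :> D", OF D])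
    fix D' assume "GDERIV (g_fun b X l) \<theta> :> D'"
    with D have "(\<lambda>h. h \<bullet> D') = (\<lambda>h. h \<bullet> ?D)"
      unfolding gderiv_def by (rule has_derivative_unique[rotated])
    then have "\<forall>h. h \<bullet> D' = h \<bullet> ?D"
      by (rule iffD1[OF fun_eq_iff])
    then show "D' = ?D"
      by (rule iffD1[OF vector_eq_ldot])
  qed
qed

end

theory Submission
  imports Defs
begin

text \<open>
  Write \<open>\<Phi> W\<close> for the stacked predictions \<open>X_t w_t\<close> and \<open>\<Phi>\<^sup>*\<close> for its adjoint, so that
  \<open>g_l \<theta>\<close> is the squared norm of row \<open>l\<close> of \<open>\<Phi>\<^sup>* \<theta>\<close>.  If \<open>W\<close> is optimal
  for \<open>\<lambda>\<close> and \<open>\<theta> = (y - \<Phi> W) / \<lambda>\<close>, then row \<open>l\<close> of \<open>\<Phi>\<^sup>* \<theta>\<close> is a subgradient of the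
  Euclidean norm at row \<open>l\<close> of \<open>W\<close>.  Hence \<open>\<theta>\<close> is feasible, row \<open>l\<close> of \<open>W\<close> vanishes when
  \<open>g_l \<theta> < 1\<close>, and \<open>\<theta>\<close> satisfies the variational inequality
  \<open>(y / \<lambda> - \<theta>) \<bullet> (z - \<theta>) \<le> 0\<close> over all feasible \<open>z\<close>, which characterises the projection.
  Combining the variational inequalities at \<open>\<lambda>\<close> and at \<open>\<lambda>'\<close> places the projection for
  \<open>\<lambda>\<close> in the ball \<open>\<Theta>(\<lambda>, \<lambda>')\<close>.
\<close>

section \<open>The stacked prediction operator and its adjoint\<close>

definition prediction :: "('n::finite \<Rightarrow> 't::finite) \<Rightarrow> real^'d^'n \<Rightarrow> real^'t^'d \<Rightarrow> real^'n" where
  "prediction b X W = (\<chi> i. \<Sum>j\<in>UNIV. X $ i $ j * W $ j $ b i)"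

text \<open>The whole \<open>\<theta>\<close> can stand in for its block, since the padded column
  vanishes outside block \<open>t\<close>.\<close>

definition prediction_adj ::
  "('n::finite \<Rightarrow> 't::finite) \<Rightarrow> real^'d^'n \<Rightarrow> real^'n \<Rightarrow> real^'t^'d" where
  "prediction_adj b X \<theta> = (\<chi> l t. column l (mat_block b X t) \<bullet> \<theta>)"

lemma row_eq_nth: "row l W = W $ l"
  by (simp add: row_def vec_lambda_eta)

lemma inner_block: "column l (mat_block b X t) \<bullet> block b v t = column l (mat_block b X t) \<bullet> v"
  by (auto simp: inner_vec_def block_def column_def mat_block_def intro!: sum.cong)

lemma sum_norm_block: "(\<Sum>t\<in>UNIV. (norm (block b v t))\<^sup>2) = (norm v)\<^sup>2"
  for b :: "'n::finite \<Rightarrow> 't::finite"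
proof -
  have "(\<Sum>t\<in>UNIV. (norm (block b v t))\<^sup>2)
      = (\<Sum>t\<in>UNIV. \<Sum>i\<in>UNIV. if b i = t then v $ i * v $ i else 0)"
    unfolding power2_norm_eq_inner
    by (auto simp: inner_vec_def block_def intro!: sum.cong)
  also have "\<dots> = (\<Sum>i\<in>UNIV. \<Sum>t\<in>UNIV. if b i = t then v $ i * v $ i else 0)"
    by (rule sum.swap)
  also have "\<dots> = (norm v)\<^sup>2"
    unfolding power2_norm_eq_inner by (simp add: inner_vec_def)
  finally show ?thesis .
qed

lemma block_residual:
  "block b y t - mat_block b X t *v column t W = block b (y - prediction b X W) t"
  by (auto simp: vec_eq_iff block_def mat_block_def prediction_def matrix_vector_mult_def
      column_def)

text \<open>The blocks partition the coordinates, so the task losses merge into one squared norm and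
  only the penalty still sees the row structure.\<close>

lemma mtfl_objective_eq:
  "mtfl_objective b X y lam W =
     1/2 * (norm (y - prediction b X W))\<^sup>2 + lam * (\<Sum>l\<in>UNIV. norm (W $ l))"
  unfolding mtfl_objective_def block_residual sum_distrib_left[symmetric] sum_norm_block
    row_eq_nth ..

text \<open>Adjointness is split by rows to match the row-wise penalty and the row-wise constraints
  \<open>g_fun\<close>.\<close>

lemma inner_prediction:
  "prediction b X W \<bullet> \<theta> = (\<Sum>l\<in>UNIV. W $ l \<bullet> prediction_adj b X \<theta> $ l)"
proof -
  have "W $ l \<bullet> prediction_adj b X \<theta> $ l = (\<Sum>i\<in>UNIV. X $ i $ l * W $ l $ b i * \<theta> $ i)" for l
  proof -
    have "W $ l \<bullet> prediction_adj b X \<theta> $ l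
        = (\<Sum>t\<in>UNIV. \<Sum>i\<in>UNIV. if b i = t then X $ i $ l * W $ l $ t * \<theta> $ i else 0)"
      by (auto simp: inner_vec_def prediction_adj_def column_def mat_block_def sum_distrib_left
          intro!: sum.cong)
    also have "\<dots> = (\<Sum>i\<in>UNIV. \<Sum>t\<in>UNIV. if b i = t then X $ i $ l * W $ l $ t * \<theta> $ i else 0)"
      by (rule sum.swap)
    finally show ?thesis by simp
  qed
  then have "(\<Sum>l\<in>UNIV. W $ l \<bullet> prediction_adj b X \<theta> $ l)
      = (\<Sum>l\<in>UNIV. \<Sum>i\<in>UNIV. X $ i $ l * W $ l $ b i * \<theta> $ i)"
    by simp
  also have "\<dots> = (\<Sum>i\<in>UNIV. \<Sum>l\<in>UNIV. X $ i $ l * W $ l $ b i * \<theta> $ i)"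
    by (rule sum.swap)
  finally show ?thesis
    by (simp add: inner_vec_def prediction_def sum_distrib_right)
qed

lemma g_fun_eq_norm: "g_fun b X l \<theta> = (norm (prediction_adj b X \<theta> $ l))\<^sup>2"
  unfolding g_fun_def inner_block power2_norm_eq_inner
  by (simp add: inner_vec_def prediction_adj_def power2_eq_square)

lemma dual_feasible_iff: "\<theta> \<in> dual_feasible b X \<longleftrightarrow> (\<forall>l. norm (prediction_adj b X \<theta> $ l) \<le> 1)"
  by (simp add: dual_feasible_def g_fun_eq_norm power_le_one_iff)

lemma zero_dual_feasible: "0 \<in> dual_feasible b X"
  by (simp add: dual_feasible_def g_fun_def inner_block)

lemma prediction_add_scaleR:
  "prediction b X (W + c *\<^sub>R V) = prediction b X W + c *\<^sub>R prediction b X V"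
  by (simp add: vec_eq_iff prediction_def algebra_simps sum.distrib sum_distrib_left)

section \<open>First-order optimality conditions for the nonsmooth objective\<close>

lemma nonneg_if_quadratic_nonneg:
  fixes c q :: real
  assumes "\<And>s. 0 < s \<Longrightarrow> s \<le> 1 \<Longrightarrow> 0 \<le> s * c + s\<^sup>2 * q"
  shows "0 \<le> c"
proof -
  \<comment> \<open>After division by \<open>s > 0\<close> the quadratic term disappears in the
    limit.\<close>
  have "((\<lambda>s. c + s * q) \<longlongrightarrow> c + 0 * q) (at_right 0)"
    by (intro tendsto_intros)
  moreover have "\<forall>\<^sub>F s in at_right 0. 0 \<le> c + s * q"
    unfolding eventually_at_right_field
  proof (intro exI[of _ 1] conjI allI impI)
    fix s :: real assume s: "0 < s" "s < 1"
    then have "0 \<le> s * (c + s * q)"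
      using assms[of s] by (simp add: algebra_simps power2_eq_square)
    with s show "0 \<le> c + s * q"
      by (simp add: zero_le_mult_iff)
  qed simp
  ultimately show ?thesis
    using tendsto_lowerbound[of "\<lambda>s. c + s * q" c "at_right 0" 0] by simp
qed

text \<open>Along the segment from \<open>W\<close> to \<open>W + V\<close> the loss is exactly
  quadratic, and convexity bounds the growth of the penalty by \<open>s * D\<close>. The penalty
  thus never has to be differentiated.\<close>

lemma mtfl_optimal_variational:
  assumes "mtfl_optimal b X y lam W" "0 < lam"
  shows "(y - prediction b X W) \<bullet> prediction b X V
      \<le> lam * ((\<Sum>l\<in>UNIV. norm (W $ l + V $ l)) - (\<Sum>l\<in>UNIV. norm (W $ l)))"
proof -
  define e where "e = y - prediction b X W"
  define p where "p = prediction b X V"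
  define D where "D = (\<Sum>l\<in>UNIV. norm (W $ l + V $ l)) - (\<Sum>l\<in>UNIV. norm (W $ l))"
  have "0 \<le> s * (lam * D - e \<bullet> p) + s\<^sup>2 * (1/2 * (p \<bullet> p))" if s: "0 < s" "s \<le> 1" for s
  proof -
    have "mtfl_objective b X y lam W \<le> mtfl_objective b X y lam (W + s *\<^sub>R V)"
      using assms(1) by (auto simp: mtfl_optimal_def is_arg_min_def not_less)
    then have "1/2 * (norm e)\<^sup>2 + lam * (\<Sum>l\<in>UNIV. norm (W $ l))
        \<le> 1/2 * (norm (e - s *\<^sub>R p))\<^sup>2 + lam * (\<Sum>l\<in>UNIV. norm (W $ l + s *\<^sub>R V $ l))"
      by (simp add: mtfl_objective_eq prediction_add_scaleR e_def p_def diff_diff_eq)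
    moreover have "(norm (e - s *\<^sub>R p))\<^sup>2 = (norm e)\<^sup>2 - 2 * s * (e \<bullet> p) + s\<^sup>2 * (p \<bullet> p)"
      unfolding power2_norm_eq_inner
      by (simp add: inner_diff_left inner_diff_right inner_commute power2_eq_square algebra_simps)
    moreover have "(\<Sum>l\<in>UNIV. norm (W $ l + s *\<^sub>R V $ l)) \<le> (\<Sum>l\<in>UNIV. norm (W $ l)) + s * D"
    proof -
      have "norm (W $ l + s *\<^sub>R V $ l) \<le> (1 - s) * norm (W $ l) + s * norm (W $ l + V $ l)" for l
      proof -
        have "W $ l + s *\<^sub>R V $ l = (1 - s) *\<^sub>R W $ l + s *\<^sub>R (W $ l + V $ l)"
          by (simp add: algebra_simps)
        then show ?thesis
          using s norm_triangle_ineq[of "(1 - s) *\<^sub>R W $ l" "s *\<^sub>R (W $ l + V $ l)"] by simp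
      qed
      then have "(\<Sum>l\<in>UNIV. norm (W $ l + s *\<^sub>R V $ l))
          \<le> (\<Sum>l\<in>UNIV. (1 - s) * norm (W $ l) + s * norm (W $ l + V $ l))"
        by (rule sum_mono)
      also have "\<dots> = (\<Sum>l\<in>UNIV. norm (W $ l)) + s * D"
        by (simp add: D_def sum.distrib sum_distrib_left[symmetric]) (simp add: algebra_simps)
      finally show ?thesis .
    qed
    then have "lam * (\<Sum>l\<in>UNIV. norm (W $ l + s *\<^sub>R V $ l))
        \<le> lam * ((\<Sum>l\<in>UNIV. norm (W $ l)) + s * D)"
      using assms(2) by simp
    ultimately show ?thesis
      by (simp add: algebra_simps)
  qed
  then have "0 \<le> lam * D - e \<bullet> p"
    by (rule nonneg_if_quadratic_nonneg)
  then show ?thesis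
    by (simp add: e_def p_def D_def)
qed

text \<open>A perturbation supported on row \<open>l\<close> alone decouples the rows.\<close>

lemma mtfl_optimal_subgradient:
  fixes X :: "real^'d::finite^'n::finite" and W :: "real^'t::finite^'d"
  assumes "mtfl_optimal b X y lam W" "0 < lam"
  defines "\<theta> \<equiv> (y - prediction b X W) /\<^sub>R lam"
  shows "v \<bullet> prediction_adj b X \<theta> $ l \<le> norm (W $ l + v) - norm (W $ l)"
proof -
  define V :: "real^'t^'d" where "V = (\<chi> j. if j = l then v else 0)"
  have "(\<Sum>j\<in>UNIV. norm (W $ j + V $ j)) - (\<Sum>j\<in>UNIV. norm (W $ j))
      = (\<Sum>j\<in>UNIV. if j = l then norm (W $ l + v) - norm (W $ l) else 0)"
    unfolding sum_subtractf[symmetric] by (intro sum.cong) (simp_all add: V_def)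
  then have diff: "(\<Sum>j\<in>UNIV. norm (W $ j + V $ j)) - (\<Sum>j\<in>UNIV. norm (W $ j))
      = norm (W $ l + v) - norm (W $ l)"
    by simp
  have "v \<bullet> prediction_adj b X \<theta> $ l
      = (\<Sum>j\<in>UNIV. if j = l then v \<bullet> prediction_adj b X \<theta> $ l else 0)"
    by simp
  also have "\<dots> = prediction b X V \<bullet> \<theta>"
    unfolding inner_prediction by (intro sum.cong) (simp_all add: V_def)
  also have "\<dots> = ((y - prediction b X W) \<bullet> prediction b X V) / lam"
    by (simp add: \<theta>_def inner_commute divide_inverse mult.commute)
  also have "\<dots> \<le> norm (W $ l + v) - norm (W $ l)"
    using mtfl_optimal_variational[OF assms(1,2), of V] assms(2)
    unfolding diff by (simp add: divide_le_eq mult.commute)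
  finally show ?thesis .
qed

text \<open>Testing with \<open>v = u\<close> gives the bound; testing with \<open>v = - w\<close>
  forces equality in Cauchy-Schwarz.\<close>

lemma norm_subgradient:
  fixes w u :: "'a::real_inner"
  assumes "\<And>v. v \<bullet> u \<le> norm (w + v) - norm w"
  shows "norm u \<le> 1" and "w \<bullet> u = norm w"
proof -
  have "u \<bullet> u \<le> norm u"
    using assms[of u] norm_triangle_ineq[of w u] by simp
  then have "norm u * norm u \<le> norm u * 1"
    by (simp add: power2_norm_eq_inner[symmetric] power2_eq_square)
  then show u: "norm u \<le> 1"
    by (cases "u = 0") auto
  have "w \<bullet> u \<le> norm w"
    using norm_cauchy_schwarz[of w u] mult_left_mono[OF u norm_ge_zero[of w]] by simp
  moreover have "norm w \<le> w \<bullet> u"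
    using assms[of "- w"] by simp
  ultimately show "w \<bullet> u = norm w"
    by simp
qed

section \<open>The projection and its characterisation by the optimal residual\<close>

lemma closest_point_eqI:
  fixes a x :: "'a::euclidean_space"
  assumes "x \<in> S" "\<And>z. z \<in> S \<Longrightarrow> (a - x) \<bullet> (z - x) \<le> 0"
  shows "closest_point S a = x"
proof -
  \<comment> \<open>\<open>closest_point\<close> is a choice operator, so uniqueness is wanted along
    with minimality; the extra squared term yields both.\<close>
  have pyth: "(dist a x)\<^sup>2 + (norm (z - x))\<^sup>2 \<le> (dist a z)\<^sup>2" if "z \<in> S" for z
  proof -
    have "(dist a z)\<^sup>2 = (dist a x)\<^sup>2 - 2 * ((a - x) \<bullet> (z - x)) + (norm (z - x))\<^sup>2"
      unfolding dist_norm power2_norm_eq_inner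
      by (simp add: inner_diff_left inner_diff_right inner_commute)
    then show ?thesis
      using assms(2)[OF that] by simp
  qed
  show ?thesis
    unfolding closest_point_def
  proof (rule some_equality)
    show "x \<in> S \<and> (\<forall>z\<in>S. dist a x \<le> dist a z)"
    proof (intro conjI ballI assms(1))
      fix z assume "z \<in> S"
      with pyth have "(dist a x)\<^sup>2 \<le> (dist a z)\<^sup>2"
        by (meson le_add_same_cancel1 order_trans zero_le_power2)
      then show "dist a x \<le> dist a z"
        by (rule power2_le_imp_le) simp
    qed
  next
    fix z assume z: "z \<in> S \<and> (\<forall>w\<in>S. dist a z \<le> dist a w)"
    then have "(dist a z)\<^sup>2 \<le> (dist a x)\<^sup>2"
      using assms(1) by (intro power_mono) auto
    with pyth[of z] z have "(norm (z - x))\<^sup>2 \<le> 0"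
      by linarith
    then show "z = x"
      by simp
  qed
qed

text \<open>The optimal \<open>W\<close> supplies an explicit candidate for the projection, so its
  properties come from the subgradient conditions rather than from the geometry of the feasible
  set.\<close>

lemma mtfl_optimal_dual:
  assumes "mtfl_optimal b X y lam W" "0 < lam"
  shows dual_opt_eq_residual: "dual_opt b X y lam = (y - prediction b X W) /\<^sub>R lam"
    and dual_opt_feasible: "dual_opt b X y lam \<in> dual_feasible b X"
    and dual_opt_variational: "z \<in> dual_feasible b X \<Longrightarrow>
      (y /\<^sub>R lam - dual_opt b X y lam) \<bullet> (z - dual_opt b X y lam) \<le> 0"
    and inactive_row_zero: "g_fun b X l (dual_opt b X y lam) < 1 \<Longrightarrow> W $ l = 0"
proof -
  define \<theta> where "\<theta> = (y - prediction b X W) /\<^sub>R lam"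
  note sub = norm_subgradient[OF mtfl_optimal_subgradient[OF assms], folded \<theta>_def]
  have feas: "\<theta> \<in> dual_feasible b X"
    by (simp add: dual_feasible_iff sub(1))
  have var: "(y /\<^sub>R lam - \<theta>) \<bullet> (z - \<theta>) \<le> 0" if z: "z \<in> dual_feasible b X" for z
  proof -
    \<comment> \<open>A feasible \<open>z\<close> pairs with each row to at most its norm, a value
      that \<open>\<theta>\<close> attains.\<close>
    have "W $ j \<bullet> prediction_adj b X z $ j \<le> norm (W $ j)" for j
      using norm_cauchy_schwarz[of "W $ j" "prediction_adj b X z $ j"] z
        mult_left_mono[of "norm (prediction_adj b X z $ j)" 1 "norm (W $ j)"]
      by (auto simp: dual_feasible_iff intro: order_trans)
    then have "prediction b X W \<bullet> z \<le> prediction b X W \<bullet> \<theta>"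
      unfolding inner_prediction sub(2) by (rule sum_mono)
    moreover have "y /\<^sub>R lam - \<theta> = prediction b X W /\<^sub>R lam"
      by (simp add: \<theta>_def algebra_simps)
    ultimately show ?thesis
      using assms(2) by (simp add: inner_diff_right mult_le_0_iff)
  qed
  have eq: "dual_opt b X y lam = \<theta>"
    unfolding dual_opt_def using feas var by (rule closest_point_eqI)
  then show "dual_opt b X y lam = (y - prediction b X W) /\<^sub>R lam"
    by (simp add: \<theta>_def)
  show "dual_opt b X y lam \<in> dual_feasible b X"
    by (simp add: eq feas)
  show "(y /\<^sub>R lam - dual_opt b X y lam) \<bullet> (z - dual_opt b X y lam) \<le> 0"
    if "z \<in> dual_feasible b X"
    using var[OF that] by (simp add: eq)
  show "W $ l = 0" if "g_fun b X l (dual_opt b X y lam) < 1"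
  proof (rule ccontr)
    assume W: "W $ l \<noteq> 0"
    \<comment> \<open>A dual row of norm below 1 cannot attain the norm of a nonzero primal
      row.\<close>
    have "norm (prediction_adj b X \<theta> $ l) < 1"
      using that by (simp add: eq g_fun_eq_norm power_less_one_iff)
    then have "norm (W $ l) * norm (prediction_adj b X \<theta> $ l) < norm (W $ l)"
      using W by simp
    with norm_cauchy_schwarz[of "W $ l" "prediction_adj b X \<theta> $ l"] sub(2)[of l] show False
      by simp
  qed
qed

section \<open>Locating the next dual optimum in the ball\<close>

lemma dual_opt_in_Theta:
  assumes "mtfl_optimal b X y lam W" "mtfl_optimal b X y lam' W'"
    and "0 < lam" "lam < lam'" "lam' < lambda_max b X y"
  shows "dual_opt b X y lam \<in> Theta b X y ls lam lam'"
proof -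
  have "0 < lam'" using assms by simp
  define u where "u = dual_opt b X y lam'"
  define x where "x = dual_opt b X y lam - u"
  define r where "r = y /\<^sub>R lam - u"
  define n where "n = y /\<^sub>R lam' - u"
  define q where "q = r - ((n \<bullet> r) / (norm n)\<^sup>2) *\<^sub>R n"
  have r_perp: "r_perp b X y ls lam lam' = q"
    using assms(5) by (simp add: r_perp_def r_vec_def n_vec_def q_def r_def n_def u_def)
  note feas = dual_opt_feasible[OF assms(1,3)] dual_opt_feasible[OF assms(2) \<open>0 < lam'\<close>]
  note var = dual_opt_variational[OF assms(1,3)] dual_opt_variational[OF assms(2) \<open>0 < lam'\<close>]
  \<comment> \<open>Each of the two dual optima serves as the test point in the inequality of the
    other.\<close>
  have "(r - x) \<bullet> (- x) \<le> 0"
    using var(1)[OF feas(2)] by (simp add: r_def x_def u_def)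
  then have xr: "x \<bullet> x \<le> r \<bullet> x"
    by (simp add: inner_diff_left)
  have nx: "n \<bullet> x \<le> 0"
    using var(2)[OF feas(1)] by (simp add: n_def x_def u_def)
  have nu: "0 \<le> n \<bullet> u"
    using var(2)[OF zero_dual_feasible] by (simp add: n_def u_def)
  have ny: "0 \<le> n \<bullet> y"
  proof -
    have "y = lam' *\<^sub>R (n + u)"
      using \<open>0 < lam'\<close> by (simp add: n_def)
    then have "n \<bullet> y = lam' * (n \<bullet> n + n \<bullet> u)"
      by (metis inner_add_right inner_scaleR_right)
    then show ?thesis
      using nu \<open>0 < lam'\<close> by simp
  qed
  have nr: "0 \<le> n \<bullet> r"
  proof -
    \<comment> \<open>Lowering the parameter moves the scaled data further along \<open>y\<close>,
      which does not point against \<open>n\<close>.\<close>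
    have "r = n + (inverse lam - inverse lam') *\<^sub>R y"
      by (simp add: r_def n_def algebra_simps)
    then have "n \<bullet> r = n \<bullet> n + (inverse lam - inverse lam') * (n \<bullet> y)"
      by (simp add: inner_add_right)
    moreover have "inverse lam' \<le> inverse lam"
      using assms(3,4) by (intro le_imp_inverse_le) auto
    ultimately show ?thesis
      using ny by simp
  qed
  \<comment> \<open>Removing the \<open>n\<close> component from \<open>r\<close> can only increase
    the product with \<open>x\<close>. Division by zero gives 0, so \<open>n = 0\<close> needs no
    separate case.\<close>
  have "(n \<bullet> r) / (norm n)\<^sup>2 * (n \<bullet> x) \<le> 0"
    using nr nx by (intro mult_nonneg_nonpos) auto
  then have xq: "x \<bullet> x \<le> x \<bullet> q"
    using xr by (simp add: q_def inner_diff_right inner_commute)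
  \<comment> \<open>The ball, shifted by \<open>u\<close>, has the segment from 0 to
    \<open>q\<close> as a diameter, so membership amounts to \<open>xq\<close>.\<close>
  have "(norm (x - (1/2) *\<^sub>R q))\<^sup>2 = x \<bullet> x - x \<bullet> q + (1/2 * norm q)\<^sup>2"
    unfolding power_mult_distrib power2_norm_eq_inner
    by (simp add: inner_diff_left inner_diff_right inner_commute power2_eq_square)
  then have "(norm (x - (1/2) *\<^sub>R q))\<^sup>2 \<le> (1/2 * norm q)\<^sup>2"
    using xq by simp
  then have "norm (x - (1/2) *\<^sub>R q) \<le> 1/2 * norm q"
    by (rule power2_le_imp_le) simp
  then show ?thesis
    by (simp add: Theta_def o_vec_def r_perp x_def u_def diff_diff_eq)
qed

section \<open>Sequential screening along the parameter path\<close>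

theorem corollary9:
  fixes b :: "'n::finite \<Rightarrow> 't::finite"
    and X :: "real^'d::finite^'n"
    and y :: "real^'n"
    and ls :: 'd
    and K :: nat
    and lam :: "nat \<Rightarrow> real"
    and W :: "nat \<Rightarrow> real^'t^'d"
    and k :: nat
    and l :: 'd
  assumes blocks_nonempty: "surj b"
    and ls: "is_arg_max (\<lambda>j. g_fun b X j y) (\<lambda>_. True) ls"
    and lam_0: "lam 0 = lambda_max b X y"
    and lam_decreasing: "\<And>i. i < K \<Longrightarrow> lam (Suc i) < lam i"
    and lam_pos: "0 < lam K"
    and W_opt: "\<And>i. i \<le> K \<Longrightarrow> mtfl_optimal b X y (lam i) (W i)"
    and k: "1 \<le> k" "k \<le> K - 1"
  shows "(\<forall>t. block b (dual_opt b X y (lam k)) t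
              = (block b y t - mat_block b X t *v column t (W k)) /\<^sub>R lam k)
         \<and> (s_score b X y ls (lam (Suc k)) (lam k) l < 1 \<longrightarrow> row l (W (Suc k)) = 0)"
proof (intro conjI allI impI)
  have anti: "lam j \<le> lam i" if "i \<le> j" "j \<le> K" for i j
    using that
  proof (induction j rule: dec_induct)
    case (step j)
    then show ?case using lam_decreasing[of j] by simp
  qed simp
  \<comment> \<open>Subtraction on naturals truncates; \<open>1 \<le> k\<close> forces
    \<open>2 \<le> K\<close>.\<close>
  have "k < K" using k by simp
  then have k_le: "k \<le> K" by simp
  have pos: "0 < lam i" if "i \<le> K" for i
    using anti[of i K] that lam_pos by simp
  \<comment> \<open>Starting at \<open>k = 1\<close> keeps \<open>lam k\<close> strictly below
    \<open>lam 0\<close>, so \<open>n_vec\<close> is the projection residual.\<close>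
  have "lam k < lambda_max b X y"
    using anti[of 1 k] lam_decreasing[of 0] k \<open>k < K\<close> lam_0 by simp
  note opt_k = W_opt[of k] and opt_Suc = W_opt[of "Suc k"]
  show "block b (dual_opt b X y (lam k)) t
      = (block b y t - mat_block b X t *v column t (W k)) /\<^sub>R lam k" for t
    unfolding block_residual dual_opt_eq_residual[OF opt_k pos, OF k_le k_le]
    by (auto simp: vec_eq_iff block_def)
  assume s: "s_score b X y ls (lam (Suc k)) (lam k) l < 1"
  have "dual_opt b X y (lam (Suc k)) \<in> Theta b X y ls (lam (Suc k)) (lam k)"
    using \<open>k < K\<close> \<open>lam k < lambda_max b X y\<close>
    by (intro dual_opt_in_Theta[OF opt_Suc opt_k] pos lam_decreasing) auto
  then have "g_fun b X l (dual_opt b X y (lam (Suc k))) \<le> s_score b X y ls (lam (Suc k)) (lam k) l"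
    using s_score_attained[of b X y ls "lam (Suc k)" "lam k" l] by force
  with s have "W (Suc k) $ l = 0"
    using \<open>k < K\<close> by (intro inactive_row_zero[OF opt_Suc pos]) auto
  then show "row l (W (Suc k)) = 0"
    by (simp add: row_eq_nth)
qed

end
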